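(* Let $H$ be a hero and let $H^-$ be the hero obtained from $H$ by adding a dominating sink, that is, by adding one new vertex $w$ together with all arcs $(h,w)$, $h\in V(H)$. If $\{\overset{\leftrightarrow}{K}_2,S_2^+,H\}$ is heroic, then so is $\{\overset{\leftrightarrow}{K}_2,S_2^+, H^-\}$.
   Context: All digraphs are finite and simple: no loops, and between two vertices at most one arc in each direction (so pairs of opposite arcs are allowed in general). $(u,v)$ denotes an arc with tail $u$ and head $v$. An acyclic $k$-coloring of a digraph $D$ is a map $c:V(D)\to S$ with $|S|=k$ such that each color class $c^{-1}(i)$, $i \in S$, induces a subdigraph without directed cycles (a digon, i.e. a pair of opposite arcs $(x,y),(y,x)$, counts as a directed cycle of length two). The dichromatic number $\vec{\chi}(D)$ is the smallest $k$ for which an acyclic $k$-coloring of $D$ exists. For a set $\mathcal{F}$ of digraphs, $\mathrm{Forb}_{\mathrm{ind}}(\mathcal{F})$ is the set of digraphs containing no induced subdigraph isomorphic to a member of $\mathcal{F}$. A finite set $\mathcal{F}$ of digraphs is called heroic if there is $C\in\mathbb{N}$ with $\vec{\chi}(D)\le C$ for all $D\in \mathrm{Forb}_{\mathrm{ind}}(\mathcal{F})$. A tournament is an orientation of a complete graph. A hero is a tournament $H$ such that the tournaments containing no (induced) subdigraph isomorphic to $H$ have bounded dichromatic number. $\overset{\leftrightarrow}{K}_2$ is the digon: two vertices joined by arcs in both directions. $S_2^+$ is the orientation of the star with $2$ leaves in which both arcs are directed away from the center. *)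

theory Defs
  imports "Graph_Theory.Graph_Theory"
begin

text \<open>
  A finite simple digraph is a \<^typ>\<open>nat pair_pre_digraph\<close> satisfying \<^const>\<open>pair_digraph\<close>:
  arcs are ordered pairs of distinct vertices, so opposite arcs are allowed and parallel arcs
  are not. Since every finite digraph has an isomorphic copy with vertices in
  \<^typ>\<open>nat\<close>, a bound over this type is a bound over all finite digraphs.
\<close>

definition contains_induced :: "nat pair_pre_digraph \<Rightarrow> nat pair_pre_digraph \<Rightarrow> bool" where
  "contains_induced D F \<longleftrightarrow>
     (\<exists>K. induced_subgraph K (with_proj D) \<and> digraph_iso (with_proj F) K)"

definition acyclic_digraph :: "('a, 'b) pre_digraph \<Rightarrow> bool" where
  "acyclic_digraph G \<longleftrightarrow> (\<nexists>p. pre_digraph.cycle G p)"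

definition acyclic_coloring :: "nat pair_pre_digraph \<Rightarrow> 'c set \<Rightarrow> (nat \<Rightarrow> 'c) \<Rightarrow> bool" where
  "acyclic_coloring D S c \<longleftrightarrow>
     c \<in> pverts D \<rightarrow> S \<and>
     (\<forall>i\<in>S. acyclic_digraph (with_proj D \<restriction> {v \<in> pverts D. c v = i}))"

definition dichromatic_number :: "nat pair_pre_digraph \<Rightarrow> nat" where
  "dichromatic_number D =
     (LEAST k. \<exists>(S :: nat set) c. finite S \<and> card S = k \<and> acyclic_coloring D S c)"

definition Forb_ind :: "nat pair_pre_digraph set \<Rightarrow> nat pair_pre_digraph set" where
  "Forb_ind \<F> = {D. pair_digraph D \<and> (\<forall>F\<in>\<F>. \<not> contains_induced D F)}"

definition heroic :: "nat pair_pre_digraph set \<Rightarrow> bool" where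
  "heroic \<F> \<longleftrightarrow> finite \<F> \<and> (\<forall>F\<in>\<F>. pair_digraph F) \<and>
     (\<exists>C. \<forall>D\<in>Forb_ind \<F>. dichromatic_number D \<le> C)"

definition tournament :: "nat pair_pre_digraph \<Rightarrow> bool" where
  "tournament T \<longleftrightarrow> pair_digraph T \<and>
     (\<forall>u\<in>pverts T. \<forall>v\<in>pverts T. u \<noteq> v \<longrightarrow> ((u, v) \<in> parcs T \<longleftrightarrow> (v, u) \<notin> parcs T))"

definition hero :: "nat pair_pre_digraph \<Rightarrow> bool" where
  "hero H \<longleftrightarrow> tournament H \<and>
     (\<exists>C. \<forall>T. tournament T \<and> \<not> contains_induced T H \<longrightarrow> dichromatic_number T \<le> C)"

definition digon :: "nat pair_pre_digraph" where
  "digon = \<lparr>pverts = {0, 1}, parcs = {(0, 1), (1, 0)}\<rparr>"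

definition S2_plus :: "nat pair_pre_digraph" where
  "S2_plus = \<lparr>pverts = {0, 1, 2}, parcs = {(0, 1), (0, 2)}\<rparr>"

definition add_dominating_sink :: "nat pair_pre_digraph \<Rightarrow> nat \<Rightarrow> nat pair_pre_digraph" where
  "add_dominating_sink H w =
     \<lparr>pverts = insert w (pverts H), parcs = parcs H \<union> {(h, w) | h. h \<in> pverts H}\<rparr>"

end

theory Submission
  imports Defs
begin

text \<open>
  Let \<open>D\<close> be a digraph without induced digon, \<open>S\<^sub>2\<^sup>+\<close> or \<open>H\<^sup>-\<close>, and let \<open>C\<close> bound the
  dichromatic number when \<open>H\<close> itself is forbidden. Every in-neighbourhood is \<open>H\<close>-free, because
  its centre would be the sink of a copy of \<open>H\<^sup>-\<close>; so it has dichromatic number at most \<open>C\<close>. Every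
  out-neighbourhood is a tournament, because two nonadjacent out-neighbours would give \<open>S\<^sub>2\<^sup>+\<close>.

  Each out-neighbourhood \<open>P\<close> moreover contains a set of boundedly many vertices such that every
  other vertex of \<open>P\<close> has an arc into it. If \<open>P\<close> contains a copy of \<open>H\<close>, this copy is such a set:
  a vertex of \<open>P\<close> without an arc into the copy is dominated by all of it, which gives \<open>H\<^sup>-\<close>.
  If \<open>P\<close> is \<open>H\<close>-free, it splits into at most \<open>C\<close> transitive tournaments, and their sinks will do
  (\<open>dicolorable_tournament_in_dominated\<close>).

  Write \<open>N[A]\<close> for the closed in-neighbourhood of \<open>A\<close>. The key fact is that, for a nonempty finite
  tournament \<open>A\<close>, all arcs that leave \<open>N[A]\<close> end in the out-neighbourhood of one single vertex
  \<open>a\<close> of \<open>A\<close> (\<open>escape_from_closed_in_nbhd\<close>). Covering that out-neighbourhood by \<open>N[A']\<close>, with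
  \<open>A'\<close> again a tournament of bounded size, and iterating, gives a chain of sets \<open>N[A\<^sub>i]\<close>, each of
  bounded dichromatic number, such that arcs advance by at most one step along the chain. Two
  palettes, used on the steps of even and of odd index, colour the union of the chain. No arc
  leaves this union, so the remaining vertices can be coloured independently with the same
  palettes (\<open>dicolorable_chain_cover\<close>). This bounds the dichromatic number of \<open>D\<close>.
\<close>

section \<open>Acyclic colourings of a relation\<close>

definition monochromatic_arcs :: "'a rel \<Rightarrow> 'a set \<Rightarrow> ('a \<Rightarrow> nat) \<Rightarrow> 'a rel" where
  "monochromatic_arcs E S c = {(u, v) \<in> E. u \<in> S \<and> v \<in> S \<and> c u = c v}"

definition dicolorable :: "'a rel \<Rightarrow> 'a set \<Rightarrow> nat \<Rightarrow> bool" where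
  "dicolorable E S k \<longleftrightarrow> (\<exists>c. (\<forall>v\<in>S. c v < k) \<and> acyclic (monochromatic_arcs E S c))"

lemma dicolorableI:
  assumes "\<And>v. v \<in> S \<Longrightarrow> c v < k" and "acyclic (monochromatic_arcs E S c)"
  shows "dicolorable E S k"
  using assms unfolding dicolorable_def by blast

lemma dicolorable_mono:
  assumes "dicolorable E T k" and "S \<subseteq> T" and "k \<le> l"
  shows "dicolorable E S l"
proof -
  obtain c where c: "\<forall>v\<in>T. c v < k" "acyclic (monochromatic_arcs E T c)"
    using assms(1) unfolding dicolorable_def by blast
  have "monochromatic_arcs E S c \<subseteq> monochromatic_arcs E T c"
    using assms(2) by (auto simp: monochromatic_arcs_def)
  with c(2) have "acyclic (monochromatic_arcs E S c)" by (rule acyclic_subset)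
  moreover have "\<forall>v\<in>S. c v < l" using c(1) assms(2,3) by fastforce
  ultimately show ?thesis unfolding dicolorable_def by blast
qed

text \<open>
  Along a closed walk a nonincreasing function is constant, so every closed walk stays in one
  fibre.
\<close>

lemma acyclic_fiberwise:
  fixes f :: "'a \<Rightarrow> nat"
  assumes noninc: "\<And>u v. (u, v) \<in> r \<Longrightarrow> f v \<le> f u"
    and fibers: "\<And>i. acyclic {(u, v) \<in> r. f u = i \<and> f v = i}"
  shows "acyclic r"
proof (rule acyclicI, intro allI notI)
  fix x assume cyc: "(x, x) \<in> r\<^sup>+"
  have le: "f y \<le> f x" if "(x, y) \<in> r\<^sup>+" for x y
    using that by (induction rule: trancl_induct) (auto dest: noninc)
  have same: "f y = f x \<longrightarrow> (x, y) \<in> {(u, v) \<in> r. f u = f x \<and> f v = f x}\<^sup>+"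
    if "(x, y) \<in> r\<^sup>+" for x y
    using that
  proof (induction rule: trancl_induct)
    case (base y)
    then show ?case by auto
  next
    case (step y z)
    show ?case
    proof
      assume z: "f z = f x"
      have "f y = f x" using le[OF step(1)] noninc[OF step(2)] z by simp
      with step z show "(x, z) \<in> {(u, v) \<in> r. f u = f x \<and> f v = f x}\<^sup>+"
        by (auto intro: trancl_into_trancl)
    qed
  qed
  show False using same[OF cyc] fibers[of "f x"] by (auto simp: acyclic_def)
qed

text \<open>
  When arcs never increase the level \<open>f\<close>, the levels can be coloured independently with one
  common palette; for two levels, this glues a set that no arc leaves to its complement.
\<close>

lemma dicolorable_nonincreasing:
  fixes f :: "'a \<Rightarrow> nat"
  assumes noninc: "\<And>u v. (u, v) \<in> E \<Longrightarrow> u \<in> S \<Longrightarrow> v \<in> S \<Longrightarrow> f v \<le> f u"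
    and fibers: "\<And>i. dicolorable E {v \<in> S. f v = i} k"
  shows "dicolorable E S k"
proof -
  have "\<forall>i. \<exists>c. (\<forall>v\<in>{v \<in> S. f v = i}. c v < k) \<and> acyclic (monochromatic_arcs E {v \<in> S. f v = i} c)"
    using fibers unfolding dicolorable_def by blast
  then have "\<exists>c. \<forall>i. (\<forall>v\<in>{v \<in> S. f v = i}. c i v < k) \<and>
      acyclic (monochromatic_arcs E {v \<in> S. f v = i} (c i))"
    by (rule choice)
  then obtain c where c: "\<And>i v. v \<in> S \<Longrightarrow> f v = i \<Longrightarrow> c i v < k"
      "\<And>i. acyclic (monochromatic_arcs E {v \<in> S. f v = i} (c i))"
    by auto
  let ?M = "monochromatic_arcs E S (\<lambda>v. c (f v) v)"
  have "acyclic ?M"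
  proof (rule acyclic_fiberwise)
    show "f v \<le> f u" if "(u, v) \<in> ?M" for u v
      using that noninc by (auto simp: monochromatic_arcs_def)
    show "acyclic {(u, v) \<in> ?M. f u = i \<and> f v = i}" for i
      using c(2)[of i] by (rule acyclic_subset) (auto simp: monochromatic_arcs_def)
  qed
  then show ?thesis using c(1) by (intro dicolorableI) auto
qed

lemma dicolorable_Un:
  assumes "dicolorable E S k" and "dicolorable E T l"
  shows "dicolorable E (S \<union> T) (k + l)"
proof -
  obtain c where c: "\<forall>v\<in>S. c v < k" "acyclic (monochromatic_arcs E S c)"
    using assms(1) unfolding dicolorable_def by blast
  obtain d where d: "\<forall>v\<in>T. d v < l" "acyclic (monochromatic_arcs E T d)"
    using assms(2) unfolding dicolorable_def by blast
  \<comment> \<open>The shift by \<open>k\<close> makes the palettes disjoint, so no monochromatic arc leaves \<open>S\<close> or enters it.\<close>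
  define e where "e v = (if v \<in> S then c v else k + d v)" for v
  have split: "u \<in> S \<longleftrightarrow> v \<in> S" if "(u, v) \<in> monochromatic_arcs E (S \<union> T) e" for u v
    using that c(1) by (auto simp: monochromatic_arcs_def e_def split: if_splits)
  have "acyclic (monochromatic_arcs E (S \<union> T) e)"
  proof (rule acyclic_fiberwise[where f = "\<lambda>v. if v \<in> S then 0 else 1"])
    fix i :: nat
    show "acyclic {(u, v) \<in> monochromatic_arcs E (S \<union> T) e.
        (if u \<in> S then 0 else 1) = i \<and> (if v \<in> S then 0 else 1) = i}"
    proof (cases "i = 0")
      case True
      from c(2) show ?thesis
        by (rule acyclic_subset) (use True in \<open>auto simp: monochromatic_arcs_def e_def split: if_splits\<close>)
    next
      case False
      from d(2) show ?thesis
        by (rule acyclic_subset) (use False in \<open>auto simp: monochromatic_arcs_def e_def split: if_splits\<close>)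
    qed
  qed (use split in auto)
  moreover have "e v < k + l" if "v \<in> S \<union> T" for v
    using that c(1) d(1) by (auto simp: e_def trans_less_add1)
  ultimately show ?thesis by (intro dicolorableI) auto
qed

lemma dicolorable_empty: "dicolorable E {} k"
  by (auto simp: dicolorable_def monochromatic_arcs_def acyclic_def)

lemma dicolorable_UN:
  assumes "finite A" and "\<And>a. a \<in> A \<Longrightarrow> dicolorable E (B a) k"
  shows "dicolorable E (\<Union>a\<in>A. B a) (card A * k)"
  using assms
proof (induction A rule: finite_induct)
  case empty
  then show ?case by (simp add: dicolorable_empty)
next
  case (insert a A)
  then have "dicolorable E (B a \<union> (\<Union>a\<in>A. B a)) (k + card A * k)"
    by (intro dicolorable_Un) auto
  then show ?case using insert by simp
qed

lemma dicolorable_singleton: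
  assumes "(v, v) \<notin> E"
  shows "dicolorable E {v} (Suc 0)"
proof -
  have "monochromatic_arcs E {v} (\<lambda>_. 0) = {}"
    using assms by (auto simp: monochromatic_arcs_def)
  then show ?thesis by (intro dicolorableI[where c = "\<lambda>_. 0"]) (auto simp: acyclic_def)
qed

text \<open>
  Arcs may go back arbitrarily far but advance by at most one layer. Among layers of equal parity
  no arc advances at all, so one palette suffices for each parity.
\<close>

lemma dicolorable_layers:
  fixes f :: "'a \<Rightarrow> nat"
  assumes step: "\<And>u v. (u, v) \<in> E \<Longrightarrow> u \<in> S \<Longrightarrow> v \<in> S \<Longrightarrow> f v \<le> Suc (f u)"
    and layers: "\<And>i. dicolorable E {v \<in> S. f v = i} k"
  shows "dicolorable E S (2 * k)"
proof -
  have parity: "dicolorable E {v \<in> S. f v mod 2 = p} k" for p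
  proof (rule dicolorable_nonincreasing)
    fix u v assume "(u, v) \<in> E" "u \<in> {v \<in> S. f v mod 2 = p}" "v \<in> {v \<in> S. f v mod 2 = p}"
    then have "f v \<le> Suc (f u)" "f v mod 2 = f u mod 2" using step by auto
    then show "f v \<le> f u" by presburger
  next
    show "dicolorable E {v \<in> {v \<in> S. f v mod 2 = p}. f v = i} k" for i
      using layers[of i] by (rule dicolorable_mono) auto
  qed
  have "dicolorable E ({v \<in> S. f v mod 2 = 0} \<union> {v \<in> S. f v mod 2 = 1}) (k + k)"
    by (intro dicolorable_Un parity)
  then show ?thesis by (rule dicolorable_mono) auto
qed

text \<open>
  Following successors from a set that contains a given vertex yields a sequence of sets whose
  union is closed under out-neighbours. Sorting the union by the first set that contains a vertex
  gives layers as in \<open>dicolorable_layers\<close>; what lies outside the union sends arcs into it but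
  receives none, and is treated by induction.
\<close>

lemma dicolorable_chain_cover:
  assumes "finite R"
    and cover: "\<And>x. x \<in> R \<Longrightarrow> \<exists>B\<in>\<C>. x \<in> B"
    and successor: "\<And>B. B \<in> \<C> \<Longrightarrow> \<exists>B'\<in>\<C>. E `` B \<subseteq> B \<union> B'"
    and col: "\<And>B. B \<in> \<C> \<Longrightarrow> dicolorable E B k"
  shows "dicolorable E R (2 * k)"
  using assms(1) cover
proof (induction R rule: finite_psubset_induct)
  case (psubset R)
  show ?case
  proof (cases "R = {}")
    case True
    then show ?thesis by (simp add: dicolorable_empty)
  next
    case False
    then obtain x B0 where x: "x \<in> R" "B0 \<in> \<C>" "x \<in> B0" using psubset.prems by blast
    obtain nxt where nxt: "\<And>B. B \<in> \<C> \<Longrightarrow> nxt B \<in> \<C> \<and> E `` B \<subseteq> B \<union> nxt B"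
      using successor by metis
    define B where "B i = (nxt ^^ i) B0" for i
    have BC: "B i \<in> \<C>" for i
      by (induction i) (auto simp: B_def x(2) nxt)
    have Bstep: "E `` B i \<subseteq> B i \<union> B (Suc i)" for i
      using nxt[OF BC[of i]] by (simp add: B_def)
    define U where "U = (\<Union>i. B i)"
    define f where "f v = (LEAST i. v \<in> B i)" for v
    have fB: "v \<in> B (f v)" if "v \<in> U" for v
      using that unfolding U_def f_def by (auto intro: LeastI)
    have fle: "f v \<le> i" if "v \<in> B i" for v i
      using that unfolding f_def by (rule Least_le)
    have inside: "dicolorable E (R \<inter> U) (2 * k)"
    proof (rule dicolorable_layers)
      fix u v assume "(u, v) \<in> E" "u \<in> R \<inter> U" "v \<in> R \<inter> U"
      then have "v \<in> B (f u) \<union> B (Suc (f u))" using fB[of u] Bstep[of "f u"] by blast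
      then show "f v \<le> Suc (f u)" using fle by fastforce
    next
      show "dicolorable E {v \<in> R \<inter> U. f v = i} k" for i
        using col[OF BC[of i]] by (rule dicolorable_mono) (use fB in auto)
    qed
    have "x \<in> B 0" using x(3) by (simp add: B_def)
    then have "R - U \<subset> R" using x(1) unfolding U_def by blast
    then have outside: "dicolorable E (R - U) (2 * k)"
      by (rule psubset.IH) (use psubset.prems in auto)
    show ?thesis
    proof (rule dicolorable_nonincreasing[where f = "\<lambda>v. if v \<in> U then 0 else 1"])
      fix u v assume "(u, v) \<in> E"
      then have "u \<in> U \<Longrightarrow> v \<in> U" using Bstep unfolding U_def by blast
      then show "(if v \<in> U then 0 else 1) \<le> (if u \<in> U then 0 else 1 :: nat)" by auto
    next
      fix i :: nat
      show "dicolorable E {v \<in> R. (if v \<in> U then 0 else 1) = i} (2 * k)"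
        using dicolorable_mono[OF inside _ order_refl] dicolorable_mono[OF outside _ order_refl]
        by (cases "i = 0") (auto simp: subset_iff)
    qed
  qed
qed

section \<open>Domination in digraphs whose out-neighbourhoods are tournaments\<close>

definition closed_in_nbhd :: "'a rel \<Rightarrow> 'a set \<Rightarrow> 'a set" where
  "closed_in_nbhd E A = A \<union> E\<inverse> `` A"

definition semicomplete_on :: "'a rel \<Rightarrow> 'a set \<Rightarrow> bool" where
  "semicomplete_on E A \<longleftrightarrow> (\<forall>u\<in>A. \<forall>v\<in>A. u \<noteq> v \<longrightarrow> (u, v) \<in> E \<or> (v, u) \<in> E)"

text \<open>
  A vertex \<open>a\<close> of maximum in-degree in the tournament \<open>A\<close> works. The out-neighbours of an
  in-neighbour of \<open>b \<in> A\<close> are equal or adjacent to \<open>b\<close>, so leaving the closed in-neighbourhood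
  means going to some \<open>v\<close> outside it that is an out-neighbour of a vertex of \<open>A\<close>. The
  in-neighbours of \<open>v\<close> in \<open>A\<close> are closed under out-neighbours in \<open>A\<close>, again because
  out-neighbourhoods are semicomplete. If \<open>a\<close> were not among them, then \<open>a\<close> and all its
  in-neighbours in \<open>A\<close> would have arcs to each of them, contradicting the choice of \<open>a\<close>.
\<close>

lemma escape_from_closed_in_nbhd:
  assumes "finite A" and "A \<noteq> {}" and tour: "semicomplete_on E A"
    and irr: "irrefl E"
    and local: "\<And>u. semicomplete_on E (E `` {u})"
  obtains a where "a \<in> A" and "E `` closed_in_nbhd E A \<subseteq> closed_in_nbhd E A \<union> E `` {a}"
proof -
  let ?indeg = "\<lambda>a. card (E\<inverse> `` {a} \<inter> A)"
  have "Max (?indeg ` A) \<in> ?indeg ` A" using assms(1,2) by (intro Max_in) auto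
  then obtain a where a: "a \<in> A" "?indeg a = Max (?indeg ` A)" by auto
  then have max: "?indeg b \<le> ?indeg a" if "b \<in> A" for b
    using that assms(1) by simp
  have cmp: "x = y \<or> (x, y) \<in> E \<or> (y, x) \<in> E" if "(u, x) \<in> E" "(u, y) \<in> E" for u x y
    using local[of u] that by (auto simp: semicomplete_on_def)
  have tour': "x = y \<or> (x, y) \<in> E \<or> (y, x) \<in> E" if "x \<in> A" "y \<in> A" for x y
    using tour that by (auto simp: semicomplete_on_def)
  have key: "v \<in> closed_in_nbhd E A \<union> E `` {a}" if b: "b \<in> A" "(b, v) \<in> E" for b v
  proof (rule ccontr)
    assume nv: "v \<notin> closed_in_nbhd E A \<union> E `` {a}"
    then have vA: "v \<notin> A" "\<And>x. x \<in> A \<Longrightarrow> (v, x) \<notin> E" and av: "(a, v) \<notin> E"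
      by (auto simp: closed_in_nbhd_def)
    have closed: "(y, v) \<in> E" if "x \<in> A" "(x, v) \<in> E" "y \<in> A" "(x, y) \<in> E" for x y
      using cmp[OF that(2) that(4)] that(3) vA by auto
    have ab: "(a, b) \<in> E"
      using tour'[OF a(1) b(1)] closed[OF b a(1)] av b(2) by auto
    have zb: "(z, b) \<in> E" if z: "z \<in> A" "(z, a) \<in> E" for z
    proof -
      have zv: "(z, v) \<notin> E" using closed[OF z(1) _ a(1) z(2)] av by auto
      then show ?thesis
        using tour'[OF b(1) z(1)] closed[OF b z(1)] b(2) by auto
    qed
    have "insert a (E\<inverse> `` {a} \<inter> A) \<subseteq> E\<inverse> `` {b} \<inter> A" using a(1) ab zb by auto
    moreover have "a \<notin> E\<inverse> `` {a} \<inter> A" using irr by (auto simp: irrefl_def)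
    ultimately have "E\<inverse> `` {a} \<inter> A \<subset> E\<inverse> `` {b} \<inter> A" by auto
    then have "?indeg a < ?indeg b"
      using assms(1) by (intro psubset_card_mono) auto
    with max[OF b(1)] show False by simp
  qed
  have all: "v \<in> closed_in_nbhd E A \<union> E `` {a}" if u: "u \<in> closed_in_nbhd E A" "(u, v) \<in> E" for u v
  proof (cases "u \<in> A")
    case True
    from key[OF this u(2)] show ?thesis .
  next
    case False
    then obtain b where b: "b \<in> A" "(u, b) \<in> E" using u by (auto simp: closed_in_nbhd_def)
    consider "v = b" | "(v, b) \<in> E" | "(b, v) \<in> E"
      using cmp[OF b(2) u(2)] by auto
    then show ?thesis
    proof cases
      case 3
      from key[OF b(1) this] show ?thesis .
    qed (use b(1) in \<open>auto simp: closed_in_nbhd_def\<close>)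
  qed
  show thesis
  proof (rule that[OF a(1)])
    show "E `` closed_in_nbhd E A \<subseteq> closed_in_nbhd E A \<union> E `` {a}"
      using all by (auto elim!: ImageE)
  qed
qed

text \<open>
  The cover consists of the closed in-neighbourhoods of tournaments on at most \<open>h\<close> vertices. Each
  is a union of at most \<open>h\<close> sets that are an in-neighbourhood plus its centre, whence the factor
  \<open>h * Suc c\<close>.
\<close>

lemma dicolorable_in_dominated:
  assumes "finite V" and "E \<subseteq> V \<times> V"
    and irr: "irrefl E"
    and local: "\<And>u. semicomplete_on E (E `` {u})"
    and innbhd: "\<And>v. v \<in> V \<Longrightarrow> dicolorable E (E\<inverse> `` {v}) c"
    and dom: "\<And>v. v \<in> V \<Longrightarrow> \<exists>A\<subseteq>E `` {v}. card A \<le> h \<and> E `` {v} \<subseteq> closed_in_nbhd E A"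
    and h: "0 < h"
  shows "dicolorable E V (2 * (h * Suc c))"
proof -
  define \<A> where "\<A> = {A. A \<subseteq> V \<and> card A \<le> h \<and> semicomplete_on E A}"
  have fin: "finite A" if "A \<in> \<A>" for A
    using that assms(1) by (auto simp: \<A>_def intro: finite_subset)
  show ?thesis
  proof (rule dicolorable_chain_cover[where \<C> = "closed_in_nbhd E ` \<A>"])
    fix x assume "x \<in> V"
    then have "{x} \<in> \<A>" using h by (auto simp: \<A>_def semicomplete_on_def)
    then show "\<exists>B\<in>closed_in_nbhd E ` \<A>. x \<in> B" by (force simp: closed_in_nbhd_def)
  next
    fix B assume "B \<in> closed_in_nbhd E ` \<A>"
    then obtain A where A: "A \<in> \<A>" "B = closed_in_nbhd E A" by blast
    show "\<exists>B'\<in>closed_in_nbhd E ` \<A>. E `` B \<subseteq> B \<union> B'"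
    proof (cases "A = {}")
      case True
      then show ?thesis using A by (auto simp: closed_in_nbhd_def)
    next
      case False
      obtain a where a: "a \<in> A" "E `` B \<subseteq> B \<union> E `` {a}"
        using escape_from_closed_in_nbhd[OF fin[OF A(1)] False _ irr local] A
        by (auto simp: \<A>_def)
      then have "a \<in> V" using A by (auto simp: \<A>_def)
      then obtain A' where A': "A' \<subseteq> E `` {a}" "card A' \<le> h" "E `` {a} \<subseteq> closed_in_nbhd E A'"
        using dom by blast
      then have "A' \<in> \<A>" using local[of a] assms(2) unfolding \<A>_def semicomplete_on_def by blast
      then show ?thesis using a A' by blast
    qed
  next
    fix B assume "B \<in> closed_in_nbhd E ` \<A>"
    then obtain A where A: "A \<in> \<A>" "B = closed_in_nbhd E A" by blast
    have "dicolorable E (\<Union>a\<in>A. {a} \<union> E\<inverse> `` {a}) (card A * Suc c)"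
    proof (rule dicolorable_UN[OF fin[OF A(1)]])
      fix a assume "a \<in> A"
      then have "a \<in> V" using A by (auto simp: \<A>_def)
      then have "dicolorable E ({a} \<union> E\<inverse> `` {a}) (Suc 0 + c)"
        using irr by (intro dicolorable_Un dicolorable_singleton innbhd) (auto simp: irrefl_def)
      then show "dicolorable E ({a} \<union> E\<inverse> `` {a}) (Suc c)" by simp
    qed
    then show "dicolorable E B (h * Suc c)"
      by (rule dicolorable_mono) (use A in \<open>auto simp: \<A>_def closed_in_nbhd_def simp del: mult_Suc_right intro: mult_le_mono1\<close>)
  qed (use assms(1) in auto)
qed

lemma acyclic_tournament_in_dominated:
  assumes "finite P" and "P \<noteq> {}" and "semicomplete_on E P" and "acyclic (E \<inter> P \<times> P)"
  obtains t where "t \<in> P" and "P \<subseteq> closed_in_nbhd E {t}"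
proof -
  have "finite (E \<inter> P \<times> P)" using assms(1) by auto
  then have "wf ((E \<inter> P \<times> P)\<inverse>)" using assms(4) by (rule finite_acyclic_wf_converse)
  then obtain t where t: "t \<in> P" "\<And>y. (y, t) \<in> (E \<inter> P \<times> P)\<inverse> \<Longrightarrow> y \<notin> P"
    using assms(2) by (metis ex_in_conv wfE_min)
  then have "P \<subseteq> closed_in_nbhd E {t}"
    using assms(3) unfolding semicomplete_on_def closed_in_nbhd_def by blast
  with t that show thesis by blast
qed

text \<open>
  A colour class is an acyclic tournament and so has a sink into which all its other vertices send
  an arc. Choosing the sink of every class gives at most as many vertices as colours.
\<close>

lemma dicolorable_tournament_in_dominated:
  assumes "finite P" and "semicomplete_on E P" and "dicolorable E P c"
  shows "\<exists>A\<subseteq>P. card A \<le> c \<and> P \<subseteq> closed_in_nbhd E A"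
proof -
  obtain g where g: "\<forall>v\<in>P. g v < c" "acyclic (monochromatic_arcs E P g)"
    using assms(3) unfolding dicolorable_def by blast
  have "\<exists>t. t \<in> P \<and> g t = i \<and> {v \<in> P. g v = i} \<subseteq> closed_in_nbhd E {t}" if "i \<in> g ` P" for i
  proof (rule acyclic_tournament_in_dominated[of "{v \<in> P. g v = i}" E])
    show "acyclic (E \<inter> {v \<in> P. g v = i} \<times> {v \<in> P. g v = i})"
      using g(2) by (rule acyclic_subset) (auto simp: monochromatic_arcs_def)
  qed (use that assms(1,2) in \<open>auto simp: semicomplete_on_def\<close>)
  then obtain t where t: "\<And>i. i \<in> g ` P \<Longrightarrow>
      t i \<in> P \<and> g (t i) = i \<and> {v \<in> P. g v = i} \<subseteq> closed_in_nbhd E {t i}"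
    by metis
  have "card (t ` g ` P) \<le> card (g ` P)" using assms(1) by (intro card_image_le) auto
  also have "\<dots> \<le> card {..<c}" using g(1) by (intro card_mono) auto
  finally have "card (t ` g ` P) \<le> c" by simp
  moreover have "P \<subseteq> closed_in_nbhd E (t ` g ` P)"
    using t unfolding closed_in_nbhd_def by blast
  moreover have "t ` g ` P \<subseteq> P" using t by auto
  ultimately show ?thesis by blast
qed

section \<open>Induced subdigraphs and the dichromatic number\<close>

lemma loopfree_arcs:
  assumes "pair_digraph D"
  shows "(v, v) \<notin> parcs D"
proof -
  interpret D: pair_digraph D by fact
  show ?thesis using D.pair_no_loops[of "(v, v)"] by auto
qed

text \<open>
  The isomorphism of arc-labelled digraphs is reduced to a vertex map that preserves and reflects
  adjacency; all later arguments with forbidden digraphs use this form.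
\<close>

lemma contains_induced_iff:
  assumes "pair_digraph D" and "pair_wf_digraph F"
  shows "contains_induced D F \<longleftrightarrow>
    (\<exists>f. inj_on f (pverts F) \<and> f ` pverts F \<subseteq> pverts D \<and>
      (\<forall>u\<in>pverts F. \<forall>v\<in>pverts F. (u, v) \<in> parcs F \<longleftrightarrow> (f u, f v) \<in> parcs D))"
    (is "_ \<longleftrightarrow> (\<exists>f. ?emb f)")
proof
  interpret F: pair_wf_digraph F by fact
  assume "contains_induced D F"
  then obtain K hom where K: "induced_subgraph K (with_proj D)"
    and iso: "pre_digraph.digraph_isomorphism (with_proj F) hom" and Keq: "K = app_iso hom (with_proj F)"
    unfolding contains_induced_def digraph_iso_def by blast
  let ?f = "iso_verts hom"
  have tl: "iso_tail hom = fst" "iso_head hom = snd"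
    using K Keq by (auto simp: induced_subgraph_def subgraph_def compatible_def)
  have arcsK: "iso_arcs hom ` parcs F = {e \<in> parcs D. fst e \<in> ?f ` pverts F \<and> snd e \<in> ?f ` pverts F}"
    using K Keq tl by (auto simp: induced_subgraph_def)
  have inj: "inj_on ?f (pverts F)"
    using iso by (simp add: pre_digraph.digraph_isomorphism_def)
  have ends: "iso_arcs hom e = (?f (fst e), ?f (snd e))" if "e \<in> parcs F" for e
    using iso that tl by (auto simp: pre_digraph.digraph_isomorphism_def prod_eq_iff)
  have "(u, v) \<in> parcs F \<longleftrightarrow> (?f u, ?f v) \<in> parcs D" if uv: "u \<in> pverts F" "v \<in> pverts F" for u v
  proof
    assume "(u, v) \<in> parcs F"
    then have "(?f u, ?f v) \<in> iso_arcs hom ` parcs F" using ends by force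
    then show "(?f u, ?f v) \<in> parcs D" using arcsK by blast
  next
    assume "(?f u, ?f v) \<in> parcs D"
    then have "(?f u, ?f v) \<in> iso_arcs hom ` parcs F" using arcsK uv by auto
    then obtain e where e: "e \<in> parcs F" "?f (fst e) = ?f u" "?f (snd e) = ?f v" using ends by auto
    moreover have "fst e \<in> pverts F" "snd e \<in> pverts F"
      using e(1) F.in_arcsD1 F.in_arcsD2 by (metis prod.collapse)+
    ultimately have "fst e = u" "snd e = v" using inj uv by (auto dest: inj_onD)
    then show "(u, v) \<in> parcs F" using e(1) by auto
  qed
  moreover have "?f ` pverts F \<subseteq> pverts D"
    using K Keq by (auto simp: induced_subgraph_def subgraph_def)
  ultimately show "\<exists>f. ?emb f" using inj by blast
next
  interpret F: pair_wf_digraph F by fact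
  interpret D: pair_digraph D by fact
  assume "\<exists>f. ?emb f"
  then obtain f where f: "?emb f" by blast
  define hom where "hom = \<lparr>iso_verts = f, iso_arcs = map_prod f f, iso_head = snd, iso_tail = fst\<rparr>"
  have arcs_verts: "fst e \<in> pverts F" "snd e \<in> pverts F" if "e \<in> parcs F" for e
    using that F.in_arcsD1 F.in_arcsD2 by (metis prod.collapse)+
  then have F_arcs: "parcs F \<subseteq> pverts F \<times> pverts F" by (metis mem_Times_iff subsetI)
  have iso: "pre_digraph.digraph_isomorphism (with_proj F) hom"
    unfolding pre_digraph.digraph_isomorphism_def hom_def
  proof (intro conjI ballI)
    show "inj_on (iso_arcs \<lparr>iso_verts = f, iso_arcs = map_prod f f, iso_head = snd, iso_tail = fst\<rparr>)
        (arcs (with_proj F))"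
      using inj_on_subset[OF map_prod_inj_on, of f "pverts F" f "pverts F" "parcs F"] f F_arcs
      by simp
  qed (use f F.wf_digraph in auto)
  have "induced_subgraph (with_proj D \<restriction> f ` pverts F) (with_proj D)"
    using f by (intro D.induced_induce) auto
  moreover have "with_proj D \<restriction> f ` pverts F = app_iso hom (with_proj F)"
  proof (rule pre_digraph.equality)
    show "arcs (with_proj D \<restriction> f ` pverts F) = arcs (app_iso hom (with_proj F))"
    proof (rule Set.set_eqI)
      fix e
      have "e \<in> parcs D \<and> fst e \<in> f ` pverts F \<and> snd e \<in> f ` pverts F
          \<longleftrightarrow> (\<exists>u\<in>pverts F. \<exists>v\<in>pverts F. e = (f u, f v) \<and> (u, v) \<in> parcs F)"
        using f by (cases e) auto
      also have "\<dots> \<longleftrightarrow> e \<in> map_prod f f ` parcs F"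
        using F_arcs by (cases e) (auto simp: image_iff, force+)
      finally show "e \<in> arcs (with_proj D \<restriction> f ` pverts F) \<longleftrightarrow> e \<in> arcs (app_iso hom (with_proj F))"
        by (simp add: hom_def)
    qed
  qed (auto simp: hom_def)
  ultimately show "contains_induced D F"
    unfolding contains_induced_def digraph_iso_def using iso by metis
qed

text \<open>
  A directed cycle is a walk without repeated vertices, while \<^const>\<open>acyclic\<close> excludes all closed
  walks; every closed walk contains a cycle.
\<close>

lemma acyclic_digraph_restrict_iff:
  assumes "pair_digraph D"
  shows "acyclic_digraph (with_proj D \<restriction> X) \<longleftrightarrow> acyclic (parcs D \<inter> X \<times> X)"
proof -
  interpret D: pair_digraph D by fact
  interpret G: wf_digraph "with_proj D \<restriction> X" by (rule D.wellformed_induce_subgraph)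
  have ends: "arcs_ends (with_proj D \<restriction> X) = parcs D \<inter> X \<times> X"
    by (auto simp: arcs_ends_conv image_iff)
  have "(\<exists>p. G.cycle p) \<longleftrightarrow> (\<exists>u. (u, u) \<in> (arcs_ends (with_proj D \<restriction> X))\<^sup>+)"
  proof
    assume "\<exists>p. G.cycle p"
    then show "\<exists>u. (u, u) \<in> (arcs_ends (with_proj D \<restriction> X))\<^sup>+"
      unfolding G.cycle_def G.reachable1_awalk by blast
  next
    assume "\<exists>u. (u, u) \<in> (arcs_ends (with_proj D \<restriction> X))\<^sup>+"
    then show "\<exists>p. G.cycle p"
      unfolding G.reachable1_awalk using G.closed_w_imp_cycle G.closed_w_def by blast
  qed
  then show ?thesis by (simp add: acyclic_digraph_def acyclic_def ends)
qed

text \<open>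
  The classes need not be tested one by one: monochromatic arcs never change the class.
\<close>

lemma acyclic_coloring_iff:
  fixes c :: "nat \<Rightarrow> nat"
  assumes "pair_digraph D"
  shows "acyclic_coloring D S c \<longleftrightarrow>
    c \<in> pverts D \<rightarrow> S \<and> acyclic (monochromatic_arcs (parcs D) (pverts D) c)"
proof -
  let ?cls = "\<lambda>i. {v \<in> pverts D. c v = i}"
  have "(\<forall>i\<in>S. acyclic (parcs D \<inter> ?cls i \<times> ?cls i)) \<longleftrightarrow>
      acyclic (monochromatic_arcs (parcs D) (pverts D) c)" if c: "c \<in> pverts D \<rightarrow> S"
  proof
    assume *: "\<forall>i\<in>S. acyclic (parcs D \<inter> ?cls i \<times> ?cls i)"
    show "acyclic (monochromatic_arcs (parcs D) (pverts D) c)"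
    proof (rule acyclic_fiberwise[where f = c])
      fix i
      have eq: "{(u, v) \<in> monochromatic_arcs (parcs D) (pverts D) c. c u = i \<and> c v = i}
          = parcs D \<inter> ?cls i \<times> ?cls i"
        by (auto simp: monochromatic_arcs_def)
      show "acyclic {(u, v) \<in> monochromatic_arcs (parcs D) (pverts D) c. c u = i \<and> c v = i}"
      proof (cases "i \<in> S")
        case True
        with * eq show ?thesis by simp
      next
        case False
        then have "?cls i = {}" using c by auto
        then show ?thesis unfolding eq
          by (metis Int_empty_right Times_empty acyclic_def trancl_empty empty_iff)
      qed
    qed (auto simp: monochromatic_arcs_def)
  next
    assume *: "acyclic (monochromatic_arcs (parcs D) (pverts D) c)"
    show "\<forall>i\<in>S. acyclic (parcs D \<inter> ?cls i \<times> ?cls i)"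
    proof
      fix i
      from * show "acyclic (parcs D \<inter> ?cls i \<times> ?cls i)"
        by (rule acyclic_subset) (auto simp: monochromatic_arcs_def)
    qed
  qed
  then show ?thesis
    unfolding acyclic_coloring_def acyclic_digraph_restrict_iff[OF assms] by blast
qed

text \<open>
  The least number in the definition is attained because giving each vertex its own colour is
  acyclic in a loopless digraph.
\<close>

lemma dichromatic_number_le_iff:
  assumes "pair_digraph D"
  shows "dichromatic_number D \<le> k \<longleftrightarrow> dicolorable (parcs D) (pverts D) k"
proof
  interpret D: pair_digraph D by fact
  let ?P = "\<lambda>k. \<exists>(S :: nat set) c. finite S \<and> card S = k \<and> acyclic_coloring D S c"
  have "monochromatic_arcs (parcs D) (pverts D) id = {}"
    using loopfree_arcs[OF assms] by (auto simp: monochromatic_arcs_def)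
  then have "acyclic_coloring D (pverts D) id"
    by (auto simp: acyclic_coloring_iff[OF assms] acyclic_def)
  then have "?P (card (pverts D))" using D.pair_finite_verts by blast
  then have "?P (dichromatic_number D)" unfolding dichromatic_number_def by (rule LeastI)
  then obtain S :: "nat set" and c where S: "finite S" "card S = dichromatic_number D"
    "acyclic_coloring D S c" by blast
  then have c: "c \<in> pverts D \<rightarrow> S" "acyclic (monochromatic_arcs (parcs D) (pverts D) c)"
    by (auto simp: acyclic_coloring_iff[OF assms])
  obtain g where g: "bij_betw g S {0..<card S}" using S(1) ex_bij_betw_finite_nat by blast
  assume le: "dichromatic_number D \<le> k"
  show "dicolorable (parcs D) (pverts D) k"
  proof (rule dicolorableI)
    fix v assume "v \<in> pverts D"
    then have "g (c v) \<in> {0..<card S}" using c(1) bij_betwE[OF g] by blast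
    then show "(g \<circ> c) v < k" using S(2) le by simp
  next
    have "inj_on g S" using g by (simp add: bij_betw_def)
    with c(1) have "monochromatic_arcs (parcs D) (pverts D) (g \<circ> c)
        \<subseteq> monochromatic_arcs (parcs D) (pverts D) c"
      by (auto simp: monochromatic_arcs_def dest: inj_onD)
    with c(2) show "acyclic (monochromatic_arcs (parcs D) (pverts D) (g \<circ> c))"
      by (rule acyclic_subset)
  qed
next
  assume "dicolorable (parcs D) (pverts D) k"
  then obtain c where "\<forall>v\<in>pverts D. c v < k" "acyclic (monochromatic_arcs (parcs D) (pverts D) c)"
    unfolding dicolorable_def by blast
  then have "acyclic_coloring D {..<k} c" by (auto simp: acyclic_coloring_iff[OF assms])
  then show "dichromatic_number D \<le> k"
    unfolding dichromatic_number_def by (intro Least_le exI[of _ "{..<k}"] exI[of _ c]) auto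
qed

definition induced_on :: "'a pair_pre_digraph \<Rightarrow> 'a set \<Rightarrow> 'a pair_pre_digraph" where
  "induced_on D X = \<lparr>pverts = X, parcs = parcs D \<inter> X \<times> X\<rparr>"

lemma induced_on_simps [simp]:
  "pverts (induced_on D X) = X"
  "parcs (induced_on D X) = parcs D \<inter> X \<times> X"
  by (simp_all add: induced_on_def)

lemma pair_digraph_induced_on:
  assumes "pair_digraph D" and "X \<subseteq> pverts D"
  shows "pair_digraph (induced_on D X)"
proof -
  interpret D: pair_digraph D by fact
  have "finite X" using assms(2) D.finite_verts by (auto intro: finite_subset)
  then show ?thesis by unfold_locales (use D.no_loops in auto)
qed

lemma contains_induced_on_iff:
  assumes "pair_digraph D" and "pair_wf_digraph F" and "X \<subseteq> pverts D"
  shows "contains_induced (induced_on D X) F \<longleftrightarrow>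
    (\<exists>f. inj_on f (pverts F) \<and> f ` pverts F \<subseteq> X \<and>
      (\<forall>u\<in>pverts F. \<forall>v\<in>pverts F. (u, v) \<in> parcs F \<longleftrightarrow> (f u, f v) \<in> parcs D))"
  unfolding contains_induced_iff[OF pair_digraph_induced_on[OF assms(1,3)] assms(2)]
  by (intro ex_cong1 conj_cong refl) (auto simp: image_subset_iff)

lemma Forb_ind_induced_on:
  assumes "D \<in> Forb_ind \<F>" and "\<And>F. F \<in> \<F> \<Longrightarrow> pair_wf_digraph F" and "X \<subseteq> pverts D"
  shows "induced_on D X \<in> Forb_ind \<F>"
proof -
  have D: "pair_digraph D" using assms(1) by (simp add: Forb_ind_def)
  have "\<not> contains_induced (induced_on D X) F" if "F \<in> \<F>" for F
  proof -
    have "\<not> contains_induced D F" using assms(1) that by (simp add: Forb_ind_def)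
    then show ?thesis
      unfolding contains_induced_on_iff[OF D assms(2)[OF that] assms(3)]
        contains_induced_iff[OF D assms(2)[OF that]]
      using assms(3) by (meson order_trans)
  qed
  then show ?thesis using pair_digraph_induced_on[OF D assms(3)] by (simp add: Forb_ind_def)
qed

section \<open>The three forbidden digraphs\<close>

lemma pair_digraph_digon: "pair_digraph digon"
  by unfold_locales (auto simp: digon_def)

lemma pair_digraph_S2_plus: "pair_digraph S2_plus"
  by unfold_locales (auto simp: S2_plus_def)

lemma pair_digraph_add_dominating_sink:
  assumes "pair_digraph H" and "w \<notin> pverts H"
  shows "pair_digraph (add_dominating_sink H w)"
proof -
  interpret H: pair_digraph H by fact
  have "{(h, w) |h. h \<in> pverts H} = (\<lambda>h. (h, w)) ` pverts H" by auto
  then have "finite {(h, w) |h. h \<in> pverts H}" by simp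
  then show ?thesis
    using H.in_arcsD1 H.in_arcsD2 H.pair_finite_verts H.pair_finite_arcs
      loopfree_arcs[OF assms(1)] assms(2)
    by unfold_locales (auto simp: add_dominating_sink_def)
qed

lemma asym_if_digon_free:
  assumes "pair_digraph D" and "\<not> contains_induced D digon"
  shows "asym (parcs D)"
proof (rule asymI, rule notI)
  interpret D: pair_digraph D by fact
  interpret F: pair_digraph digon by (rule pair_digraph_digon)
  fix u v assume uv: "(u, v) \<in> parcs D" "(v, u) \<in> parcs D"
  then have neq: "u \<noteq> v" "(u, u) \<notin> parcs D" "(v, v) \<notin> parcs D"
    using loopfree_arcs[OF assms(1)] by metis+
  have "u \<in> pverts D" "v \<in> pverts D" using uv D.in_arcsD1 by auto
  with uv neq have "contains_induced D digon"
    unfolding contains_induced_iff[OF assms(1) F.pair_wf_digraph]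
    by (intro exI[of _ "\<lambda>n. if n = 0 then u else v"]) (auto simp: digon_def)
  with assms(2) show False by simp
qed

lemma semicomplete_out_nbhd_if_S2_plus_free:
  assumes "pair_digraph D" and "asym (parcs D)" and "\<not> contains_induced D S2_plus"
  shows "semicomplete_on (parcs D) (parcs D `` {u})"
  unfolding semicomplete_on_def
proof (intro ballI impI, rule ccontr)
  interpret D: pair_digraph D by fact
  interpret F: pair_digraph S2_plus by (rule pair_digraph_S2_plus)
  fix v w
  assume vw: "v \<in> parcs D `` {u}" "w \<in> parcs D `` {u}" "v \<noteq> w"
    and nadj: "\<not> ((v, w) \<in> parcs D \<or> (w, v) \<in> parcs D)"
  have loops: "(x, x) \<notin> parcs D" for x by (rule loopfree_arcs) fact
  have "u \<in> pverts D" "v \<in> pverts D" "w \<in> pverts D" "u \<noteq> v" "u \<noteq> w"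
    using vw loops D.in_arcsD1 D.in_arcsD2 by auto
  moreover have "(v, u) \<notin> parcs D" "(w, u) \<notin> parcs D" using vw assms(2) by (auto dest: asymD)
  ultimately have "contains_induced D S2_plus"
    unfolding contains_induced_iff[OF assms(1) F.pair_wf_digraph] using vw nadj loops
    by (intro exI[of _ "\<lambda>n. if n = 0 then u else if n = 1 then v else w"])
      (auto simp: S2_plus_def inj_on_def)
  with assms(3) show False by simp
qed

lemma contains_add_dominating_sinkI:
  assumes D: "pair_digraph D" and H: "pair_digraph H" and w: "w \<notin> pverts H"
    and f: "inj_on f (pverts H)" "f ` pverts H \<subseteq> pverts D"
      "\<And>x y. x \<in> pverts H \<Longrightarrow> y \<in> pverts H \<Longrightarrow> (x, y) \<in> parcs H \<longleftrightarrow> (f x, f y) \<in> parcs D"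
    and v: "v \<in> pverts D" "\<And>x. x \<in> pverts H \<Longrightarrow> (f x, v) \<in> parcs D \<and> (v, f x) \<notin> parcs D"
  shows "contains_induced D (add_dominating_sink H w)"
proof -
  interpret D: pair_digraph D by fact
  interpret H: pair_digraph H by fact
  interpret F: pair_digraph "add_dominating_sink H w"
    by (rule pair_digraph_add_dominating_sink[OF H w])
  have loops: "(x, x) \<notin> parcs D" for x by (rule loopfree_arcs) fact
  have [simp]: "(w, x) \<notin> parcs H" "(x, w) \<notin> parcs H" for x
    using w H.in_arcsD1 H.in_arcsD2 by auto
  have "v \<notin> f ` pverts H" using v(2) loops by auto
  then show ?thesis
    unfolding contains_induced_iff[OF D F.pair_wf_digraph] using f v loops w
    by (intro exI[of _ "f(w := v)"])
      (auto simp: add_dominating_sink_def inj_on_def image_iff)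
qed

text \<open>
  The parameter \<open>h\<close> covers both ways in which an out-neighbourhood is dominated: by a copy of
  \<open>H\<close>, or by the sinks of at most \<open>C\<close> colour classes.
\<close>

lemma heroic_add_dominating_sink:
  assumes w: "w \<notin> pverts H" and heroicH: "heroic {digon, S2_plus, H}"
  shows "heroic {digon, S2_plus, add_dominating_sink H w}"
proof -
  have H: "pair_digraph H" using heroicH by (auto simp: heroic_def)
  interpret H: pair_digraph H by (rule H)
  obtain C where C: "\<And>D. D \<in> Forb_ind {digon, S2_plus, H} \<Longrightarrow> dichromatic_number D \<le> C"
    using heroicH by (auto simp: heroic_def)
  have pdg: "pair_digraph F" if "F \<in> {digon, S2_plus, add_dominating_sink H w}" for F
    using that pair_digraph_digon pair_digraph_S2_plus pair_digraph_add_dominating_sink[OF H w] by auto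
  \<comment> \<open>The successor makes \<open>h\<close> positive, so that single vertices can start a chain.\<close>
  define h where "h = Suc (max (card (pverts H)) C)"
  have "dichromatic_number D \<le> 2 * (h * Suc C)"
    if "D \<in> Forb_ind {digon, S2_plus, add_dominating_sink H w}" for D
  proof -
    from that have D: "pair_digraph D" and free: "\<not> contains_induced D digon"
      "\<not> contains_induced D S2_plus" "\<not> contains_induced D (add_dominating_sink H w)"
      by (auto simp: Forb_ind_def)
    interpret D: pair_digraph D by (rule D)
    let ?E = "parcs D" and ?V = "pverts D"
    have asym: "asym ?E" by (rule asym_if_digon_free[OF D free(1)])
    have local: "semicomplete_on ?E (?E `` {u})" for u
      by (rule semicomplete_out_nbhd_if_S2_plus_free[OF D asym free(2)])
    have H_free_dicolorable: "dicolorable ?E X C"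
      if X: "X \<subseteq> ?V" "\<not> contains_induced (induced_on D X) H" for X
    proof -
      have pdgX: "pair_digraph (induced_on D X)" by (rule pair_digraph_induced_on[OF D X(1)])
      have "induced_on D X \<in> Forb_ind {digon, S2_plus}"
        by (rule Forb_ind_induced_on) (use D free X pair_digraph_digon pair_digraph_S2_plus
          in \<open>auto simp: Forb_ind_def pair_digraph_def pair_fin_digraph_def\<close>)
      then have "induced_on D X \<in> Forb_ind {digon, S2_plus, H}"
        using X(2) by (auto simp: Forb_ind_def)
      then have "dicolorable (?E \<inter> X \<times> X) X C"
        using C[of "induced_on D X"] dichromatic_number_le_iff[OF pdgX, of C] by simp
      moreover have "monochromatic_arcs (?E \<inter> X \<times> X) X c = monochromatic_arcs ?E X c" for c
        by (auto simp: monochromatic_arcs_def)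
      ultimately show ?thesis by (simp add: dicolorable_def)
    qed
    have "dicolorable ?E ?V (2 * (h * Suc C))"
    proof (rule dicolorable_in_dominated[OF _ _ _ local])
      show "?E \<subseteq> ?V \<times> ?V" using D.in_arcsD1 D.in_arcsD2 by auto
      show "irrefl ?E" using loopfree_arcs[OF D] by (simp add: irrefl_def)
      fix v assume v: "v \<in> ?V"
      have sub: "?E\<inverse> `` {v} \<subseteq> ?V" "?E `` {v} \<subseteq> ?V" using D.in_arcsD1 D.in_arcsD2 by auto
      show "dicolorable ?E (?E\<inverse> `` {v}) C"
      proof (rule H_free_dicolorable[OF sub(1)], rule notI)
        assume "contains_induced (induced_on D (?E\<inverse> `` {v})) H"
        then obtain f where "inj_on f (pverts H)" "f ` pverts H \<subseteq> ?E\<inverse> `` {v}"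
          "\<forall>x\<in>pverts H. \<forall>y\<in>pverts H. (x, y) \<in> parcs H \<longleftrightarrow> (f x, f y) \<in> ?E"
          unfolding contains_induced_on_iff[OF D H.pair_wf_digraph sub(1)] by blast
        then have "contains_induced D (add_dominating_sink H w)"
          using sub v asym by (intro contains_add_dominating_sinkI[OF D H w]) (auto dest: asymD)
        with free show False by simp
      qed
      show "\<exists>A\<subseteq>?E `` {v}. card A \<le> h \<and> ?E `` {v} \<subseteq> closed_in_nbhd ?E A"
      proof (cases "contains_induced (induced_on D (?E `` {v})) H")
        case True
        then obtain f where f: "inj_on f (pverts H)" "f ` pverts H \<subseteq> ?E `` {v}"
          "\<forall>x\<in>pverts H. \<forall>y\<in>pverts H. (x, y) \<in> parcs H \<longleftrightarrow> (f x, f y) \<in> ?E"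
          unfolding contains_induced_on_iff[OF D H.pair_wf_digraph sub(2)] by blast
        have "z \<in> closed_in_nbhd ?E (f ` pverts H)" if z: "z \<in> ?E `` {v}" for z
        proof (rule ccontr)
          assume nz: "z \<notin> closed_in_nbhd ?E (f ` pverts H)"
          have "(f x, z) \<in> ?E \<and> (z, f x) \<notin> ?E" if "x \<in> pverts H" for x
            using that f(2) z nz local[of v] unfolding semicomplete_on_def closed_in_nbhd_def by blast
          then have "contains_induced D (add_dominating_sink H w)"
            using f z sub by (intro contains_add_dominating_sinkI[OF D H w, of f z]) auto
          with free show False by simp
        qed
        moreover have "card (f ` pverts H) \<le> h"
          using card_image_le[OF H.finite_verts, of f] by (simp add: h_def)
        ultimately show ?thesis using f(2) by blast
      next
        case False
        have "finite (?E `` {v})" using sub(2) D.finite_verts by (auto intro: finite_subset)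
        from dicolorable_tournament_in_dominated[OF this local H_free_dicolorable[OF sub(2) False]]
        obtain A where "A \<subseteq> ?E `` {v}" "card A \<le> C" "?E `` {v} \<subseteq> closed_in_nbhd ?E A" by blast
        moreover have "C \<le> h" by (simp add: h_def)
        ultimately show ?thesis by (meson order_trans)
      qed
    qed (use D.finite_verts in \<open>auto simp: h_def\<close>)
    then show ?thesis by (simp add: dichromatic_number_le_iff[OF D])
  qed
  then show ?thesis using pdg unfolding heroic_def by blast
qed

theorem theorem4:
  fixes H :: "nat pair_pre_digraph" and w :: nat
  assumes "hero H"
    and "w \<notin> pverts H"
    and "heroic {digon, S2_plus, H}"
  shows "heroic {digon, S2_plus, add_dominating_sink H w}"
  using assms(2,3) by (rule heroic_add_dominating_sink)

end
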